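(* Let $K>0$ and let $f:[0,\infty)\to[0,\infty)$ satisfy the following conditions. (1) $f$ is continuous, $f(0)=0$, $f(x)>0$ for all $x>0$; the only fixed points of $f$ are $0$ and $K$; $f(x)>x$ for all $0<x<K$ and $f(x)<x$ for all $x>K$. (2) There exists $\lambda\in(0,1)$ such that for every $x>0$ either $|f(x)-K|\le\lambda|x-K|$ or $(f(x)-K)(x-K)>0$. (3) $\liminf_{x\to\infty}(x-f(x))>0$. Let $(\gamma_n)_{n\ge1}$ be a real sequence with $\lim_{n\to\infty}\gamma_n=0$. Then any solution $(x_n)_{n\ge0}$, with $x_0>0$, of $$x_{n+1}=\max\{f(x_n)+\gamma_{n+1},0\},\quad n=0,1,\dots,$$ converges either to $K$ or to $0$.
   Context: A solution of the difference equation is the sequence generated by the recursion from its initial value $x_0$. *)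

theory Defs
  imports "HOL-Analysis.Analysis"
begin

end

theory Submission
  imports Defs
begin

text \<open>
  Away from \<open>0\<close> and \<open>K\<close> the map \<open>f\<close> strictly decreases the distance to \<open>K\<close>, and on
  \<open>{t. \<epsilon> \<le> t \<and> \<delta> \<le> \<bar>t - K\<bar>}\<close> it does so by at least a fixed amount \<open>c > 0\<close>: this follows by
  compactness for bounded \<open>t\<close> and from the contraction and liminf conditions near infinity. Once the
  perturbation is smaller than \<open>c / 2\<close>, an orbit that stays above \<open>\<epsilon>\<close> must therefore get close to \<open>K\<close>.
  An orbit below \<open>\<epsilon>\<close> either remains there or enters the interval \<open>[\<epsilon>, K]\<close>, because \<open>f\<close> is small near
  \<open>0\<close>, and the ball of radius \<open>K - \<epsilon>\<close> around \<open>K\<close> traps it. So an orbit exceeding \<open>\<epsilon>\<close> infinitely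
  often converges to \<open>K\<close>.
\<close>

text \<open>In the first alternative of \<open>contr\<close>, \<open>l < 1\<close> makes the
  decrease strict. In the second, \<open>f t\<close> lies on the same side of \<open>K\<close> as
  \<open>t\<close>, and \<open>above\<close> or \<open>below\<close> puts it strictly between
  them.\<close>

lemma dist_fixpoint_less:
  fixes f :: "real \<Rightarrow> real"
  assumes above: "\<And>t. 0 < t \<Longrightarrow> t < K \<Longrightarrow> f t > t"
    and below: "\<And>t. t > K \<Longrightarrow> f t < t"
    and contr: "\<And>t. t > 0 \<Longrightarrow> \<bar>f t - K\<bar> \<le> l * \<bar>t - K\<bar> \<or> (f t - K) * (t - K) > 0"
    and l: "l < 1" and t: "t > 0" "t \<noteq> K"
  shows "\<bar>f t - K\<bar> < \<bar>t - K\<bar>"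
  using contr[OF t(1)]
proof
  assume "\<bar>f t - K\<bar> \<le> l * \<bar>t - K\<bar>"
  moreover have "l * \<bar>t - K\<bar> < 1 * \<bar>t - K\<bar>"
    using l t by (intro mult_strict_right_mono) auto
  ultimately show ?thesis by simp
next
  assume "(f t - K) * (t - K) > 0"
  then show ?thesis
    using above[of t] below[of t] t by (auto simp: zero_less_mult_iff)
qed

lemma dist_fixpoint_gap:
  fixes f :: "real \<Rightarrow> real"
  assumes cont: "continuous_on {0..} f"
    and above: "\<And>t. 0 < t \<Longrightarrow> t < K \<Longrightarrow> f t > t"
    and below: "\<And>t. t > K \<Longrightarrow> f t < t"
    and contr: "\<And>t. t > 0 \<Longrightarrow> \<bar>f t - K\<bar> \<le> l * \<bar>t - K\<bar> \<or> (f t - K) * (t - K) > 0"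
    and l: "l < 1"
    and liminf: "Liminf at_top (\<lambda>t. ereal (t - f t)) > 0"
    and eps: "\<epsilon> > 0" and del: "\<delta> > 0"
  shows "\<exists>c>0. \<forall>t\<ge>\<epsilon>. \<bar>t - K\<bar> \<ge> \<delta> \<longrightarrow> \<bar>f t - K\<bar> \<le> \<bar>t - K\<bar> - c"
proof -
  obtain a where a: "0 < a" "ereal a < Liminf at_top (\<lambda>t. ereal (t - f t))"
    using ereal_dense2[OF liminf] by auto
  have "eventually (\<lambda>t. a < t - f t) at_top"
    using less_LiminfD[OF a(2)] by simp
  then obtain M where M: "\<And>t. t \<ge> M \<Longrightarrow> a < t - f t"
    by (auto simp: eventually_at_top_linorder)
  define B where "B = max M K"
  define S where "S = {\<epsilon>..B} \<inter> {t. \<delta> \<le> \<bar>t - K\<bar>}"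
  have "closed {t. \<delta> \<le> \<bar>t - K\<bar>}"
    by (intro closed_Collect_le continuous_intros)
  then have S_compact: "compact S"
    unfolding S_def by (intro compact_Int_closed) auto
  have "\<exists>b>0. \<forall>t\<in>S. b \<le> \<bar>t - K\<bar> - \<bar>f t - K\<bar>"
  proof (cases "S = {}")
    case True
    then show ?thesis by (auto intro: exI[of _ 1])
  next
    case False
    have "S \<subseteq> {0..}"
      using eps by (auto simp: S_def)
    then have "continuous_on S (\<lambda>t. \<bar>t - K\<bar> - \<bar>f t - K\<bar>)"
      by (intro continuous_intros continuous_on_subset[OF cont])
    from continuous_attains_inf[OF S_compact False this]
    obtain s where s: "s \<in> S" "\<forall>t\<in>S. \<bar>s - K\<bar> - \<bar>f s - K\<bar> \<le> \<bar>t - K\<bar> - \<bar>f t - K\<bar>"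
      by blast
    have "\<bar>f s - K\<bar> < \<bar>s - K\<bar>"
      by (rule dist_fixpoint_less[OF above below contr l])
        (use s(1) eps del in \<open>auto simp: S_def\<close>)
    with s(2) show ?thesis
      by (intro exI[of _ "\<bar>s - K\<bar> - \<bar>f s - K\<bar>"]) auto
  qed
  then obtain b where b: "b > 0" "\<And>t. t \<in> S \<Longrightarrow> b \<le> \<bar>t - K\<bar> - \<bar>f t - K\<bar>"
    by blast
  \<comment> \<open>\<open>b\<close> serves the compact range \<open>t \<le> B\<close>. Beyond it,
    \<open>a\<close> serves images that stay at or above \<open>K\<close>, and
    \<open>(1 - l) * \<delta>\<close> images that jump below \<open>K\<close>, where only the
    contraction alternative can hold.\<close>
  define c where "c = min b (min a ((1 - l) * \<delta>))"
  have "c > 0"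
    using a b l del by (simp add: c_def)
  moreover have "\<bar>f t - K\<bar> \<le> \<bar>t - K\<bar> - c" if t: "t \<ge> \<epsilon>" "\<bar>t - K\<bar> \<ge> \<delta>" for t
  proof (cases "t \<le> B")
    case True
    then have "b \<le> \<bar>t - K\<bar> - \<bar>f t - K\<bar>"
      using t by (intro b(2)) (auto simp: S_def)
    then show ?thesis by (simp add: c_def)
  next
    case False
    then have tB: "t > K" "a < t - f t"
      using M[of t] by (auto simp: B_def)
    show ?thesis
    proof (cases "f t \<ge> K")
      case True
      then show ?thesis using tB by (auto simp: c_def)
    next
      case False
      then have "\<not> (f t - K) * (t - K) > 0"
        using tB by (auto simp: zero_less_mult_iff)
      then have "\<bar>f t - K\<bar> \<le> l * \<bar>t - K\<bar>"
        using contr[of t] t eps by auto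
      moreover have "(1 - l) * \<delta> \<le> (1 - l) * \<bar>t - K\<bar>"
        using l t by (intro mult_left_mono) auto
      moreover have "c \<le> (1 - l) * \<delta>"
        by (simp add: c_def)
      ultimately show ?thesis by (simp add: algebra_simps)
    qed
  qed
  ultimately show ?thesis by blast
qed

theorem theorem3p5:
  fixes K :: real and f :: "real \<Rightarrow> real" and \<gamma> x :: "nat \<Rightarrow> real"
  assumes K_pos: "K > 0"
    and f_maps: "f \<in> {0..} \<rightarrow> {0..}"
    and f_cont: "continuous_on {0..} f"
    and f_zero: "f 0 = 0"
    and f_pos: "\<And>t. t > 0 \<Longrightarrow> f t > 0"
    and f_fixed: "{t \<in> {0..}. f t = t} = {0, K}"
    and f_above: "\<And>t. 0 < t \<Longrightarrow> t < K \<Longrightarrow> f t > t"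
    and f_below: "\<And>t. t > K \<Longrightarrow> f t < t"
    and f_contr: "\<exists>l. 0 < l \<and> l < 1 \<and>
          (\<forall>t>0. \<bar>f t - K\<bar> \<le> l * \<bar>t - K\<bar> \<or> (f t - K) * (t - K) > 0)"
    and f_liminf: "Liminf at_top (\<lambda>t. ereal (t - f t)) > 0"
    and gamma_lim: "\<gamma> \<longlonglongrightarrow> 0"
    and x_init: "x 0 > 0"
    and x_rec: "\<And>n. x (Suc n) = max (f (x n) + \<gamma> (Suc n)) 0"
  shows "x \<longlonglongrightarrow> K \<or> x \<longlonglongrightarrow> 0"
proof (rule disjCI)
  assume not_zero: "\<not> x \<longlonglongrightarrow> 0"
  obtain l where l: "l < 1"
    and contr: "\<And>t. t > 0 \<Longrightarrow> \<bar>f t - K\<bar> \<le> l * \<bar>t - K\<bar> \<or> (f t - K) * (t - K) > 0"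
    using f_contr by blast
  have x_nonneg: "x n \<ge> 0" for n
    using x_init x_rec by (cases n) auto
  obtain \<epsilon>\<^sub>1 where e1: "\<epsilon>\<^sub>1 > 0" "\<And>N. \<exists>n\<ge>N. x n \<ge> \<epsilon>\<^sub>1"
    using not_zero x_nonneg by (force simp: LIMSEQ_iff not_less)
  obtain \<epsilon>\<^sub>2 where e2: "\<epsilon>\<^sub>2 > 0" "\<And>t. 0 \<le> t \<Longrightarrow> t < \<epsilon>\<^sub>2 \<Longrightarrow> f t < K / 2"
  proof -
    have "\<exists>d>0. \<forall>t\<in>{0..}. dist t 0 < d \<longrightarrow> dist (f t) (f 0) < K / 2"
      using f_cont K_pos unfolding continuous_on_iff
      by (meson atLeast_iff half_gt_zero order_refl)
    then show thesis
      using that f_zero by (force simp: dist_real_def)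
  qed
  \<comment> \<open>\<open>\<epsilon>\<^sub>1\<close> is reached infinitely often, below
    \<open>\<epsilon>\<^sub>2\<close> the values of \<open>f\<close> are under \<open>K / 2\<close>,
    and the cap \<open>K / 2\<close> keeps \<open>K - \<epsilon>\<close> positive.\<close>
  define \<epsilon> where "\<epsilon> = min (min \<epsilon>\<^sub>1 \<epsilon>\<^sub>2) (K / 2)"
  have eps: "\<epsilon> > 0" "\<epsilon> \<le> K / 2" and f_small: "\<And>t. 0 \<le> t \<Longrightarrow> t < \<epsilon> \<Longrightarrow> f t < K / 2"
    using e1 e2 K_pos by (auto simp: \<epsilon>_def)
  have frequently: "\<exists>n\<ge>N. x n \<ge> \<epsilon>" for N
    using e1(2)[of N] by (force simp: \<epsilon>_def)
  \<comment> \<open>Truncation at 0 does no harm: since \<open>K > 0\<close>, replacing a negative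
    value by 0 only brings it closer to \<open>K\<close>.\<close>
  have step: "\<bar>x (Suc n) - K\<bar> \<le> \<bar>f (x n) - K\<bar> + \<bar>\<gamma> (Suc n)\<bar>" for n
    using K_pos unfolding x_rec by (auto simp: max_def)
  have f_nonexp: "\<bar>f t - K\<bar> \<le> \<bar>t - K\<bar>" if "t > 0" for t
    using dist_fixpoint_less[OF f_above f_below contr l that] contr[OF that] by (cases "t = K") auto

  have close: "\<exists>N. \<forall>n\<ge>N. \<bar>x n - K\<bar> \<le> 2 * \<delta>" if del: "\<delta> > 0" "2 * \<delta> \<le> K - \<epsilon>" for \<delta>
  proof -
    obtain c where c: "c > 0"
      "\<And>t. t \<ge> \<epsilon> \<Longrightarrow> \<bar>t - K\<bar> \<ge> \<delta> \<Longrightarrow> \<bar>f t - K\<bar> \<le> \<bar>t - K\<bar> - c"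
      using dist_fixpoint_gap[OF f_cont f_above f_below contr l f_liminf eps(1) del(1)] by blast
    \<comment> \<open>The bound \<open>c / 2\<close> spares half of the gap, \<open>\<delta>\<close>
      keeps images of the \<open>\<delta>\<close>-ball within \<open>2 * \<delta>\<close>, and
      \<open>K / 2\<close> keeps images of points below \<open>\<epsilon>\<close> under
      \<open>K\<close>.\<close>
    define r where "r = min (c / 2) (min \<delta> (K / 2))"
    have "r > 0"
      using c del K_pos by (simp add: r_def)
    then obtain N where N: "\<And>n. n \<ge> N \<Longrightarrow> \<bar>\<gamma> n\<bar> < r"
      using gamma_lim by (auto simp: LIMSEQ_iff)
    have g: "\<bar>\<gamma> (Suc n)\<bar> < c / 2" "\<bar>\<gamma> (Suc n)\<bar> < \<delta>" "\<bar>\<gamma> (Suc n)\<bar> < K / 2" if "n \<ge> N" for n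
      using N[of "Suc n"] that by (auto simp: r_def)
    have far: "\<bar>x (Suc n) - K\<bar> \<le> \<bar>x n - K\<bar> - c / 2"
      if "n \<ge> N" "x n \<ge> \<epsilon>" "\<bar>x n - K\<bar> \<ge> \<delta>" for n
      using step[of n] c(2)[OF that(2,3)] g(1)[OF that(1)] by linarith
    have near: "\<bar>x (Suc n) - K\<bar> \<le> 2 * \<delta>"
      if "n \<ge> N" "x n \<ge> \<epsilon>" "\<bar>x n - K\<bar> \<le> \<delta>" for n
      using step[of n] f_nonexp[of "x n"] g(2)[OF that(1)] that eps(1) by linarith
    \<comment> \<open>Since \<open>R \<le> K - \<epsilon>\<close>, points of the ball are at least
      \<open>\<epsilon>\<close>, so \<open>far\<close> or \<open>near\<close> applies. The radius is
      left free because both \<open>K - \<epsilon>\<close> and \<open>2 * \<delta>\<close> are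
      needed.\<close>
    have trap: "\<bar>x m - K\<bar> \<le> R"
      if "n \<ge> N" "\<bar>x n - K\<bar> \<le> R" "2 * \<delta> \<le> R" "R \<le> K - \<epsilon>" "m \<ge> n" for n m R
      using that(5)
    proof (induction m rule: dec_induct)
      case base
      then show ?case using that by simp
    next
      case (step m)
      have "x m \<ge> \<epsilon>" "m \<ge> N"
        using step that by auto
      then show ?case
        using far[of m] near[of m] step.IH that(3) c(1) by linarith
    qed
    have "\<exists>n\<ge>N. \<bar>x n - K\<bar> \<le> 2 * \<delta>"
    proof (rule ccontr)
      assume "\<not> ?thesis"
      then have away: "\<bar>x n - K\<bar> > 2 * \<delta>" if "n \<ge> N" for n
        using that by (meson not_le)
      \<comment> \<open>Otherwise each step would cost at least \<open>c / 2\<close>, and the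
        distance to \<open>K\<close> would become negative.\<close>
      have not_above: "\<exists>m\<ge>n. x m < \<epsilon>" if n: "n \<ge> N" for n
      proof (rule ccontr)
        assume "\<not> ?thesis"
        then have ge: "x m \<ge> \<epsilon>" if "m \<ge> n" for m
          using that by (auto simp: not_less)
        have decr: "\<bar>x (n + k) - K\<bar> \<le> \<bar>x n - K\<bar> - real k * (c / 2)" for k
        proof (induction k)
          case (Suc k)
          have "\<bar>x (Suc (n + k)) - K\<bar> \<le> \<bar>x (n + k) - K\<bar> - c / 2"
            using far[of "n + k"] ge[of "n + k"] away[of "n + k"] n del(1) by simp
          with Suc show ?case by (simp add: field_simps)
        qed simp
        obtain k :: nat where "\<bar>x n - K\<bar> < real k * (c / 2)"
          using reals_Archimedean3[of "c / 2"] c(1) by auto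
        with decr[of k] show False by linarith
      qed
      have not_trapped: "\<bar>x n - K\<bar> > K - \<epsilon>" if n: "n \<ge> N" for n
      proof (rule ccontr)
        assume "\<not> ?thesis"
        then have "\<bar>x m - K\<bar> \<le> K - \<epsilon>" if "m \<ge> n" for m
          using trap[of n "K - \<epsilon>" m] n del(2) that by simp
        then have "x m \<ge> \<epsilon>" if "m \<ge> n" for m
          using that by fastforce
        then show False
          using not_above[OF n] by force
      qed
      \<comment> \<open>The next point is at most \<open>K\<close>, and \<open>not_trapped\<close>
        excludes the interval from \<open>\<epsilon>\<close> to \<open>K\<close>. Hence one visit
        below \<open>\<epsilon>\<close> is permanent, against \<open>frequently\<close>.\<close>
      have stay: "x (Suc n) < \<epsilon>" if "n \<ge> N" "x n < \<epsilon>" for n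
      proof -
        have "x (Suc n) \<le> K"
          using x_rec[of n] f_small[OF x_nonneg that(2)] g(3)[OF that(1)] K_pos by auto
        then show ?thesis
          using not_trapped[of "Suc n"] that(1) by auto
      qed
      obtain n where n: "n \<ge> N" "x n < \<epsilon>"
        using not_above[of N] by auto
      have "x m < \<epsilon>" if "m \<ge> n" for m
        using that
      proof (induction m rule: dec_induct)
        case base
        then show ?case using n by simp
      next
        case (step m)
        then show ?case using stay[of m] n(1) by simp
      qed
      with frequently[of n] show False by force
    qed
    then obtain n where "n \<ge> N" "\<bar>x n - K\<bar> \<le> 2 * \<delta>"
      by blast
    then show ?thesis
      using trap[of n "2 * \<delta>"] del(2) by auto
  qed

  show "x \<longlonglongrightarrow> K"
  proof (rule LIMSEQ_I)
    fix e :: real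
    assume e: "e > 0"
    \<comment> \<open>The quarter gives \<open>2 * \<delta> \<le> e / 2\<close>, hence the strict
      bound by \<open>e\<close>; the other term meets the size condition of
      \<open>close\<close>.\<close>
    define \<delta> where "\<delta> = min (e / 4) ((K - \<epsilon>) / 2)"
    have "\<delta> > 0" "2 * \<delta> \<le> K - \<epsilon>" "2 * \<delta> < e"
      using e eps K_pos by (auto simp: \<delta>_def min_def)
    then show "\<exists>N. \<forall>n\<ge>N. norm (x n - K) < e"
      using close[of \<delta>] by (metis order_le_less_trans real_norm_def)
  qed
qed

end
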